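(* Let $J,J_1,\alpha\in\mathbb{R}$ and $\beta>0$. The Potts model with spin values in $[0,1]$ on the Cayley tree $\Gamma_2$ of order two with $J_3=0$, i.e. with formal Hamiltonian $$H(\sigma)=-J\sum_{\rangle y,z\langle}\delta(\sigma(y),\sigma(z))-J_1\sum_{\langle x,y\rangle}\delta(\sigma(x),\sigma(y))-\alpha\sum_{x\in V}\sigma(x),$$ where $\delta$ is the Kronecker symbol, the first sum is over all pairs of second neighbours $\rangle y,z\langle$ (pairs of distinct direct successors of a common vertex) and the second over all pairs of nearest neighbours, has a unique splitting Gibbs measure.
   Context: The Kronecker symbol is $\delta(u,v)=1$ if $u=v$ and $0$ otherwise. The Cayley tree $\Gamma_2=(V,L)$ of order two is the infinite tree in which every vertex has exactly 3 neighbours. Fix a root $x^0$; $d$ is the graph distance, $W_n=\{x\in V: d(x,x^0)=n\}$, $V_n=\{x\in V: d(x,x^0)\le n\}$, and for $x\in W_n$, $S(x)=\{y\in W_{n+1}: d(x,y)=1\}$ is the set of direct successors. For $\sigma\in[0,1]^{V_n}$, $n\ge1$, the Hamiltonian on $V_n$ is $$H(\sigma)=-J\sum_{x\in V_{n-1}}\ \sum_{\{y,z\}\subset S(x),\ y\neq z}\delta(\sigma(y),\sigma(z))-J_1\sum_{\langle x,y\rangle\in L:\ x,y\in V_n}\delta(\sigma(x),\sigma(y))-\alpha\sum_{x\in V_n}\sigma(x).$$ Let $h:[0,1]\times(V\setminus\{x^0\})\to\mathbb{R}$, $(t,x)\mapsto h_{t,x}$, be measurable and bounded in $t$ for each $x$.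 For $n\ge1$ let $\mu^{(n)}$ be the probability density on $[0,1]^{V_n}$ with respect to product Lebesgue measure given by $\mu^{(n)}(\sigma_n)=Z_n^{-1}\exp(-\beta H(\sigma_n)+\sum_{x\in W_n}h_{\sigma_n(x),x})$, $Z_n$ the normalizing constant. The densities are compatible if for all $n\ge2$ and $\sigma_{n-1}\in[0,1]^{V_{n-1}}$, $\int_{[0,1]^{W_n}}\mu^{(n)}(\sigma_{n-1}\vee\omega_n)\,\lambda_{W_n}(d\omega_n)=\mu^{(n-1)}(\sigma_{n-1})$, where $\lambda_{W_n}$ is product Lebesgue measure and $\vee$ is concatenation. If they are compatible, the unique probability measure $\mu$ on $[0,1]^V$ whose marginal on $[0,1]^{V_n}$ has density $\mu^{(n)}$ for all $n\ge1$ is the splitting Gibbs measure corresponding to $h$. A splitting Gibbs measure of the model is a measure arising in this way from some such $h$. *)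

theory Defs
  imports "HOL-Probability.Probability"
begin

text \<open>
  Undirected graphs are given by a vertex set \<open>V\<close> and a set \<open>L\<close> of two-element subsets of \<open>V\<close>.
  A walk is the nonempty list of the vertices it visits; its length is the number of edges
  traversed, that is, the length of the list minus one.
\<close>

definition walk :: "'v set \<Rightarrow> 'v set set \<Rightarrow> 'v list \<Rightarrow> bool" where
  "walk V L p \<longleftrightarrow> p \<noteq> [] \<and> set p \<subseteq> V \<and> successively (\<lambda>x y. {x, y} \<in> L) p"

definition graph_dist :: "'v set \<Rightarrow> 'v set set \<Rightarrow> 'v \<Rightarrow> 'v \<Rightarrow> nat" where
  "graph_dist V L x y =
     (LEAST k. \<exists>p. walk V L p \<and> hd p = x \<and> last p = y \<and> length p = Suc k)"

definition connected_graph :: "'v set \<Rightarrow> 'v set set \<Rightarrow> bool" where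
  "connected_graph V L \<longleftrightarrow> (\<forall>x\<in>V. \<forall>y\<in>V. \<exists>p. walk V L p \<and> hd p = x \<and> last p = y)"

definition acyclic_graph :: "'v set \<Rightarrow> 'v set set \<Rightarrow> bool" where
  "acyclic_graph V L \<longleftrightarrow>
     \<not> (\<exists>p. walk V L p \<and> distinct p \<and> 3 \<le> length p \<and> {last p, hd p} \<in> L)"

definition cayley_tree_order2 :: "'v set \<Rightarrow> 'v set set \<Rightarrow> bool" where
  "cayley_tree_order2 V L \<longleftrightarrow>
     infinite V \<and> (\<forall>e\<in>L. e \<subseteq> V \<and> card e = 2) \<and>
     connected_graph V L \<and> acyclic_graph V L \<and>
     (\<forall>x\<in>V. card {y. {x, y} \<in> L} = 3)"

definition sphere_at :: "'v set \<Rightarrow> 'v set set \<Rightarrow> 'v \<Rightarrow> nat \<Rightarrow> 'v set" where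
  "sphere_at V L x0 n = {x \<in> V. graph_dist V L x x0 = n}"

definition ball_at :: "'v set \<Rightarrow> 'v set set \<Rightarrow> 'v \<Rightarrow> nat \<Rightarrow> 'v set" where
  "ball_at V L x0 n = {x \<in> V. graph_dist V L x x0 \<le> n}"

definition succs :: "'v set \<Rightarrow> 'v set set \<Rightarrow> 'v \<Rightarrow> 'v \<Rightarrow> 'v set" where
  "succs V L x0 x =
     {y \<in> sphere_at V L x0 (graph_dist V L x x0 + 1). graph_dist V L x y = 1}"

definition kdelta :: "'a \<Rightarrow> 'a \<Rightarrow> real" where
  "kdelta u v = (if u = v then 1 else 0)"

text \<open>
  \<open>pair_delta \<sigma> e\<close> is \<open>\<delta>(\<sigma>(y), \<sigma>(z))\<close> for an unordered pair \<open>e = {y, z}\<close>, so that the sums in the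
  Hamiltonian run over unordered pairs, each counted once.
\<close>

definition pair_delta :: "('v \<Rightarrow> real) \<Rightarrow> 'v set \<Rightarrow> real" where
  "pair_delta \<sigma> e = (THE d. \<exists>y z. e = {y, z} \<and> d = kdelta (\<sigma> y) (\<sigma> z))"

lemma pair_delta_doubleton: "pair_delta \<sigma> {y, z} = kdelta (\<sigma> y) (\<sigma> z)"
  unfolding pair_delta_def
  by (rule the_equality) (auto simp: doubleton_eq_iff kdelta_def)

definition hamiltonian ::
  "'v set \<Rightarrow> 'v set set \<Rightarrow> 'v \<Rightarrow> real \<Rightarrow> real \<Rightarrow> real \<Rightarrow> nat \<Rightarrow> ('v \<Rightarrow> real) \<Rightarrow> real" where
  "hamiltonian V L x0 J J1 \<alpha> n \<sigma> =
     - J * (\<Sum>x\<in>ball_at V L x0 (n - 1). \<Sum>e\<in>{e. e \<subseteq> succs V L x0 x \<and> card e = 2}. pair_delta \<sigma> e)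
     - J1 * (\<Sum>e\<in>{e \<in> L. e \<subseteq> ball_at V L x0 n}. pair_delta \<sigma> e)
     - \<alpha> * (\<Sum>x\<in>ball_at V L x0 n. \<sigma> x)"

text \<open>Lebesgue measure on the Borel sets of the spin space \<open>[0,1]\<close>.\<close>

definition spin_measure :: "real measure" where
  "spin_measure = restrict_space lborel {0..1}"

text \<open>
  Configurations on \<open>A \<subseteq> V\<close> are the elements of \<open>A \<rightarrow>\<^sub>E {0..1}\<close>, the space of this product measure.
\<close>

definition conf_measure :: "'v set \<Rightarrow> ('v \<Rightarrow> real) measure" where
  "conf_measure A = PiM A (\<lambda>_. spin_measure)"

text \<open>
  Only the values \<open>h t x\<close> with \<open>t \<in> [0,1]\<close> and \<open>x \<in> V - {x0}\<close> are ever used.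
\<close>

definition boundary_field :: "'v set \<Rightarrow> 'v \<Rightarrow> (real \<Rightarrow> 'v \<Rightarrow> real) \<Rightarrow> bool" where
  "boundary_field V x0 h \<longleftrightarrow>
     (\<forall>x\<in>V - {x0}. (\<lambda>t. h t x) \<in> borel_measurable spin_measure \<and>
                     bounded ((\<lambda>t. h t x) ` {0..1}))"

definition boltzmann_weight ::
  "'v set \<Rightarrow> 'v set set \<Rightarrow> 'v \<Rightarrow> real \<Rightarrow> real \<Rightarrow> real \<Rightarrow> real \<Rightarrow> (real \<Rightarrow> 'v \<Rightarrow> real)
     \<Rightarrow> nat \<Rightarrow> ('v \<Rightarrow> real) \<Rightarrow> real" where
  "boltzmann_weight V L x0 J J1 \<alpha> \<beta> h n \<sigma> =
     exp (- \<beta> * hamiltonian V L x0 J J1 \<alpha> n \<sigma> + (\<Sum>x\<in>sphere_at V L x0 n. h (\<sigma> x) x))"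

definition partition_function ::
  "'v set \<Rightarrow> 'v set set \<Rightarrow> 'v \<Rightarrow> real \<Rightarrow> real \<Rightarrow> real \<Rightarrow> real \<Rightarrow> (real \<Rightarrow> 'v \<Rightarrow> real)
     \<Rightarrow> nat \<Rightarrow> real" where
  "partition_function V L x0 J J1 \<alpha> \<beta> h n =
     (LINT \<sigma>|conf_measure (ball_at V L x0 n). boltzmann_weight V L x0 J J1 \<alpha> \<beta> h n \<sigma>)"

definition gibbs_density ::
  "'v set \<Rightarrow> 'v set set \<Rightarrow> 'v \<Rightarrow> real \<Rightarrow> real \<Rightarrow> real \<Rightarrow> real \<Rightarrow> (real \<Rightarrow> 'v \<Rightarrow> real)
     \<Rightarrow> nat \<Rightarrow> ('v \<Rightarrow> real) \<Rightarrow> real" where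
  "gibbs_density V L x0 J J1 \<alpha> \<beta> h n \<sigma> =
     boltzmann_weight V L x0 J J1 \<alpha> \<beta> h n \<sigma> / partition_function V L x0 J J1 \<alpha> \<beta> h n"

definition compatible ::
  "'v set \<Rightarrow> 'v set set \<Rightarrow> 'v \<Rightarrow> real \<Rightarrow> real \<Rightarrow> real \<Rightarrow> real \<Rightarrow> (real \<Rightarrow> 'v \<Rightarrow> real) \<Rightarrow> bool" where
  "compatible V L x0 J J1 \<alpha> \<beta> h \<longleftrightarrow>
     (\<forall>n\<ge>2. \<forall>\<sigma> \<in> ball_at V L x0 (n - 1) \<rightarrow>\<^sub>E {0..1}.
        (LINT \<omega>|conf_measure (sphere_at V L x0 n).
           gibbs_density V L x0 J J1 \<alpha> \<beta> h n
             (merge (ball_at V L x0 (n - 1)) (sphere_at V L x0 n) (\<sigma>, \<omega>)))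
        = gibbs_density V L x0 J J1 \<alpha> \<beta> h (n - 1) \<sigma>)"

definition splitting_gibbs_measure_for ::
  "'v set \<Rightarrow> 'v set set \<Rightarrow> 'v \<Rightarrow> real \<Rightarrow> real \<Rightarrow> real \<Rightarrow> real \<Rightarrow> (real \<Rightarrow> 'v \<Rightarrow> real)
     \<Rightarrow> ('v \<Rightarrow> real) measure \<Rightarrow> bool" where
  "splitting_gibbs_measure_for V L x0 J J1 \<alpha> \<beta> h \<mu> \<longleftrightarrow>
     prob_space \<mu> \<and> sets \<mu> = sets (conf_measure V) \<and>
     (\<forall>n\<ge>1. distr \<mu> (conf_measure (ball_at V L x0 n)) (\<lambda>\<sigma>. restrict \<sigma> (ball_at V L x0 n)) =
        density (conf_measure (ball_at V L x0 n))
          (\<lambda>\<sigma>. ennreal (gibbs_density V L x0 J J1 \<alpha> \<beta> h n \<sigma>)))"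

definition splitting_gibbs_measure ::
  "'v set \<Rightarrow> 'v set set \<Rightarrow> 'v \<Rightarrow> real \<Rightarrow> real \<Rightarrow> real \<Rightarrow> real \<Rightarrow> ('v \<Rightarrow> real) measure \<Rightarrow> bool" where
  "splitting_gibbs_measure V L x0 J J1 \<alpha> \<beta> \<mu> \<longleftrightarrow>
     (\<exists>h. boundary_field V x0 h \<and> compatible V L x0 J J1 \<alpha> \<beta> h \<and>
          splitting_gibbs_measure_for V L x0 J J1 \<alpha> \<beta> h \<mu>)"

end

theory Submission
  imports Defs
begin

text \<open>
  Every Kronecker delta that involves an integrated spin vanishes almost everywhere, so integrating
  the spins of \<open>W\<^sub>n\<close> out of the Boltzmann weight multiplies the free weight on \<open>V\<^bsub>n-1\<^esub>\<close> by a constant.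
  Comparing with the density on \<open>V\<^bsub>n-1\<^esub>\<close>, compatibility forces \<open>\<Sum>x\<in>W\<^bsub>n-1\<^esub>. h\<^bsub>\<sigma>(x),x\<^esub>\<close> to be independent
  of \<open>\<sigma>\<close>, hence every \<open>h\<^bsub>t,x\<^esub>\<close> to be independent of \<open>t\<close>. Such a field cancels against the
  normalisation, and the density is almost everywhere a product of the one-site densities
  proportional to \<open>exp (\<beta> \<alpha> t)\<close>. The unique splitting Gibbs measure is therefore
  the infinite product of these, and it does arise, from \<open>h = 0\<close>.
\<close>

section \<open>Balls and spheres\<close>

lemma graph_dist_self:
  assumes "x \<in> V"
  shows "graph_dist V L x x = 0"
  unfolding graph_dist_def
  by (rule Least_eq_0) (use assms in \<open>auto simp: walk_def intro!: exI[of _ "[x]"]\<close>)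

lemma graph_dist_le:
  assumes "walk V L p"
  shows "graph_dist V L (hd p) (last p) \<le> length p - 1"
proof -
  have "length p = Suc (length p - 1)"
    using assms by (cases p) (auto simp: walk_def)
  with assms show ?thesis
    unfolding graph_dist_def by (intro Least_le) blast
qed

text \<open>Connectedness makes the set of walk lengths nonempty, so the \<open>LEAST\<close> in the
  distance is attained.\<close>

lemma connected_graph_shortest_walk:
  assumes "connected_graph V L" "x \<in> V" "y \<in> V"
  obtains p where "walk V L p" "hd p = x" "last p = y" "length p = Suc (graph_dist V L x y)"
proof -
  obtain p where p: "walk V L p" "hd p = x" "last p = y"
    using assms unfolding connected_graph_def by blast
  have "length p = Suc (length p - 1)"
    using p by (cases p) (auto simp: walk_def)
  with p have "\<exists>k p. walk V L p \<and> hd p = x \<and> last p = y \<and> length p = Suc k"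
    by blast
  from LeastI_ex[OF this] that show ?thesis
    unfolding graph_dist_def by blast
qed

locale rooted_cayley_tree =
  fixes V :: "'v set" and L :: "'v set set" and x0 :: 'v
  assumes tree: "cayley_tree_order2 V L" and root: "x0 \<in> V"
begin

abbreviation B :: "nat \<Rightarrow> 'v set" where "B \<equiv> ball_at V L x0"
abbreviation W :: "nat \<Rightarrow> 'v set" where "W \<equiv> sphere_at V L x0"

lemma connected: "connected_graph V L"
  using tree unfolding cayley_tree_order2_def by blast

lemma edge_card: "e \<in> L \<Longrightarrow> card e = 2"
  using tree unfolding cayley_tree_order2_def by blast

lemma finite_neighbours:
  assumes "x \<in> V"
  shows "finite {y. {x, y} \<in> L}"
proof -
  have "card {y. {x, y} \<in> L} = 3"
    using tree assms unfolding cayley_tree_order2_def by blast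
  then show ?thesis
    by (metis card.infinite zero_neq_numeral)
qed

text \<open>Unless \<open>x\<close> is the root, deleting the first vertex of a shortest walk from
  \<open>x\<close> to \<open>x0\<close> leaves a walk from a neighbour that is one step
  shorter.\<close>

lemma ball_Suc_neighbour:
  assumes "x \<in> B (Suc n)"
  shows "x = x0 \<or> (\<exists>y\<in>B n. {y, x} \<in> L)"
proof -
  have x: "x \<in> V" "graph_dist V L x x0 \<le> Suc n"
    using assms by (auto simp: ball_at_def)
  obtain p where p: "walk V L p" "hd p = x" "last p = x0" "length p = Suc (graph_dist V L x x0)"
    using connected_graph_shortest_walk[OF connected x(1) root] .
  then obtain q where q: "p = x # q"
    by (cases p) (auto simp: walk_def)
  show ?thesis
  proof (cases q)
    case Nil
    then show ?thesis using p q by simp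
  next
    case (Cons y r)
    have "walk V L q" "{x, y} \<in> L" "y \<in> V"
      using p(1) q Cons by (auto simp: walk_def)
    moreover have "graph_dist V L y x0 \<le> n"
      using graph_dist_le[OF \<open>walk V L q\<close>] p q Cons x(2) by simp
    ultimately show ?thesis
      by (auto simp: ball_at_def insert_commute)
  qed
qed

text \<open>Degrees are finite, so each increase of the radius adds finitely many vertices. Without
  finiteness the sums and products over balls would collapse to default values.\<close>

lemma finite_ball: "finite (B n)"
proof (induction n)
  case 0
  \<comment> \<open>Distance 0 is attained by a walk with one vertex, whose first and last vertices
    agree.\<close>
  have "x = x0" if "x \<in> B 0" for x
  proof -
    have "x \<in> V" "graph_dist V L x x0 = 0"
      using that by (auto simp: ball_at_def)
    with connected_graph_shortest_walk[OF connected \<open>x \<in> V\<close> root] obtain p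
      where "hd p = x" "last p = x0" "length p = Suc 0"
      by metis
    then show ?thesis by (auto simp: length_Suc_conv)
  qed
  then show ?case
    by (intro finite_subset[of "B 0" "{x0}"]) auto
next
  case (Suc n)
  have "B (Suc n) \<subseteq> insert x0 (\<Union>y\<in>B n. {x. {y, x} \<in> L})"
    using ball_Suc_neighbour by blast
  moreover have "finite \<dots>"
    using Suc finite_neighbours by (auto simp: ball_at_def)
  ultimately show ?case
    by (rule finite_subset)
qed

lemma sphere_subset_ball: "W n \<subseteq> B n"
  by (auto simp: sphere_at_def ball_at_def)

lemma finite_sphere: "finite (W n)"
  using finite_subset[OF sphere_subset_ball finite_ball] .

lemma ball_mono: "m \<le> n \<Longrightarrow> B m \<subseteq> B n"
  by (auto simp: ball_at_def)

lemma ball_subset: "B n \<subseteq> V"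
  by (auto simp: ball_at_def)

lemma ball_split: "n \<ge> 1 \<Longrightarrow> B n = B (n - 1) \<union> W n"
  by (auto simp: ball_at_def sphere_at_def)

lemma ball_sphere_disjoint: "n \<ge> 1 \<Longrightarrow> B (n - 1) \<inter> W n = {}"
  by (auto simp: ball_at_def sphere_at_def)

lemma sphere_subset: "n \<ge> 1 \<Longrightarrow> W n \<subseteq> V - {x0}"
  using graph_dist_self[OF root] by (auto simp: sphere_at_def)

text \<open>Guarantees that the field at each vertex other than the root occurs in the density of
  some radius at least 1.\<close>

lemma in_sphere:
  assumes "x \<in> V - {x0}"
  obtains n where "n \<ge> 1" "x \<in> W n"
proof -
  have x: "x \<in> V" "x \<noteq> x0" using assms by auto
  obtain p where p: "hd p = x" "last p = x0" "length p = Suc (graph_dist V L x x0)"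
    using connected_graph_shortest_walk[OF connected x(1) root] .
  have "graph_dist V L x x0 \<noteq> 0"
  proof
    assume "graph_dist V L x x0 = 0"
    with p x(2) show False by (auto simp: length_Suc_conv)
  qed
  with x that[of "graph_dist V L x x0"] show ?thesis
    by (auto simp: sphere_at_def)
qed

lemma finite_subset_ball:
  assumes "finite A" "A \<subseteq> V"
  obtains n where "n \<ge> 1" "A \<subseteq> B n"
proof -
  \<comment> \<open>The \<open>Suc\<close> makes the radius at least 1, as demanded; for empty
    \<open>A\<close> the unspecified value of \<open>Max\<close> is harmless.\<close>
  have "graph_dist V L x x0 \<le> Suc (Max ((\<lambda>x. graph_dist V L x x0) ` A))" if "x \<in> A" for x
    using assms that by (intro le_SucI Max_ge) auto
  with assms that[of "Suc (Max ((\<lambda>x. graph_dist V L x x0) ` A))"] show ?thesis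
    by (auto simp: ball_at_def)
qed

lemma succs_subset: "x \<in> W n \<Longrightarrow> succs V L x0 x \<subseteq> W (Suc n)"
  by (auto simp: succs_def sphere_at_def)

lemma succs_subset_ball: "x \<in> B n \<Longrightarrow> succs V L x0 x \<subseteq> B (Suc n)"
  by (auto simp: succs_def sphere_at_def ball_at_def)

end

section \<open>Spin configurations\<close>

lemma space_spin_measure [simp]: "space spin_measure = {0..1}"
  by (simp add: spin_measure_def space_restrict_space)

lemma prob_space_spin_measure: "prob_space spin_measure"
  by (rule prob_spaceI)
     (simp add: spin_measure_def space_restrict_space emeasure_restrict_space)

lemma measurable_spin_ident [measurable]: "(\<lambda>t. t) \<in> borel_measurable spin_measure"
  unfolding spin_measure_def by (rule measurable_restrict_space1) simp

text \<open>Points are Lebesgue null; all almost sure distinctness of spins rests on this.\<close>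

lemma AE_spin_measure_neq: "AE t in spin_measure. t \<noteq> c"
  unfolding spin_measure_def
  by (subst AE_restrict_space_iff) (use AE_lborel_singleton[of c] in auto)

lemma space_conf_measure: "space (conf_measure A) = A \<rightarrow>\<^sub>E {0..1}"
  by (simp add: conf_measure_def space_PiM)

lemma prob_space_conf_measure: "prob_space (conf_measure A)"
  unfolding conf_measure_def by (intro prob_space_PiM prob_space_spin_measure)

lemma measurable_conf_component [measurable (raw)]:
  assumes "x \<in> A"
  shows "(\<lambda>\<sigma>. \<sigma> x) \<in> measurable (conf_measure A) spin_measure"
  unfolding conf_measure_def using assms by measurable

lemma borel_measurable_conf_component:
  assumes "x \<in> A"
  shows "(\<lambda>\<sigma>. \<sigma> x) \<in> borel_measurable (conf_measure A)"
  using measurable_compose[OF measurable_conf_component[OF assms] measurable_spin_ident] .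

lemma integral_conf_prod:
  assumes "finite A" "\<And>x. x \<in> A \<Longrightarrow> integrable spin_measure (f x)"
  shows "(LINT \<omega>|conf_measure A. (\<Prod>x\<in>A. f x (\<omega> x))) = (\<Prod>x\<in>A. (LINT t|spin_measure. f x t :: real))"
proof -
  interpret S: prob_space spin_measure by (rule prob_space_spin_measure)
  interpret product_sigma_finite "\<lambda>_. spin_measure" ..
  show ?thesis
    unfolding conf_measure_def by (rule product_integral_prod[OF assms])
qed

lemma AE_conf_measure_neq_const:
  assumes "y \<in> A"
  shows "AE \<omega> in conf_measure A. \<omega> y \<noteq> c"
  unfolding conf_measure_def
  by (rule AE_PiM_component[OF prob_space_spin_measure assms AE_spin_measure_neq])

text \<open>Once the value at \<open>y\<close> is fixed, the independent spin at \<open>z\<close>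
  almost surely avoids it; Fubini then makes the diagonal a null set.\<close>

lemma AE_conf_measure_neq:
  assumes "y \<in> A" "z \<in> A" "y \<noteq> z"
  shows "AE \<omega> in conf_measure A. \<omega> y \<noteq> \<omega> z"
proof -
  define A' where "A' = A - {y}"
  have A: "A = insert y A'" "z \<in> A'" "y \<notin> A'"
    using assms by (auto simp: A'_def)
  interpret S: prob_space spin_measure by (rule prob_space_spin_measure)
  interpret C: prob_space "conf_measure A'" by (rule prob_space_conf_measure)
  interpret pair_sigma_finite spin_measure "conf_measure A'" ..
  have [measurable]: "(\<lambda>\<omega>. \<omega> z) \<in> borel_measurable (conf_measure A')"
    using A by (intro borel_measurable_conf_component)
  have *: "AE p in spin_measure \<Otimes>\<^sub>M conf_measure A'. fst p \<noteq> snd p z"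
  proof (rule AE_pair_measure)
    have "AE \<omega> in conf_measure A'. fst (x, \<omega>) \<noteq> snd (x, \<omega>) z" for x
      using AE_conf_measure_neq_const[OF A(2), of x] by eventually_elim auto
    then show "AE x in spin_measure. AE \<omega> in conf_measure A'. fst (x, \<omega>) \<noteq> snd (x, \<omega>) z"
      by simp
  qed measurable
  have "AE p in spin_measure \<Otimes>\<^sub>M conf_measure A'.
          (\<lambda>(x, X). X(y := x)) p y \<noteq> (\<lambda>(x, X). X(y := x)) p z"
    using * by (rule AE_mp) (use assms in auto)
  \<comment> \<open>Reinserting the coordinate \<open>y\<close> pushes the pair measure forward to
    \<open>conf_measure A\<close>, which carries the claim over.\<close>
  then have "AE \<omega> in distr (spin_measure \<Otimes>\<^sub>M conf_measure A') (conf_measure A) (\<lambda>(x, X). X(y := x)).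
               \<omega> y \<noteq> \<omega> z"
  proof (subst AE_distr_iff)
    show "(\<lambda>(x, X). X(y := x)) \<in> measurable (spin_measure \<Otimes>\<^sub>M conf_measure A') (conf_measure A)"
      unfolding conf_measure_def A(1) by measurable
    show "{\<omega> \<in> space (conf_measure A). \<omega> y \<noteq> \<omega> z} \<in> sets (conf_measure A)"
      using assms by (intro borel_measurable_neq borel_measurable_conf_component)
  qed
  also have "distr (spin_measure \<Otimes>\<^sub>M conf_measure A') (conf_measure A) (\<lambda>(x, X). X(y := x)) = conf_measure A"
    unfolding conf_measure_def A(1)
    by (rule distr_pair_PiM_eq_PiM) (rule prob_space_spin_measure)+
  finally show ?thesis .
qed

text \<open>Finiteness allows the null sets of all pairs to be united. The set \<open>T\<close>
  stands for the values of spins held fixed while those on \<open>A\<close> are integrated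
  out.\<close>

lemma AE_conf_measure_generic:
  assumes "finite A" "finite T"
  shows "AE \<omega> in conf_measure A. inj_on \<omega> A \<and> \<omega> ` A \<inter> T = {}"
proof -
  have "AE \<omega> in conf_measure A. \<forall>y\<in>A. \<forall>z\<in>A. y \<noteq> z \<longrightarrow> \<omega> y \<noteq> \<omega> z"
    using assms AE_conf_measure_neq by (intro AE_finite_allI) auto
  moreover have "AE \<omega> in conf_measure A. \<forall>y\<in>A. \<forall>c\<in>T. \<omega> y \<noteq> c"
    using assms AE_conf_measure_neq_const by (intro AE_finite_allI) auto
  ultimately show ?thesis
    by eventually_elim (auto simp: inj_on_def)
qed

section \<open>Kronecker deltas as functions of the configuration\<close>

lemma measurable_pair_delta:
  assumes "e \<subseteq> A" "card e = 2"
  shows "(\<lambda>\<sigma>. pair_delta \<sigma> e) \<in> borel_measurable (conf_measure A)"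
proof -
  obtain y z where e: "e = {y, z}" "y \<in> A" "z \<in> A"
    using assms by (auto simp: card_2_iff)
  note [measurable] = borel_measurable_conf_component[OF e(2)] borel_measurable_conf_component[OF e(3)]
  show ?thesis
    unfolding e(1) pair_delta_doubleton kdelta_def by measurable
qed

lemma pair_delta_eq_0:
  assumes "inj_on \<sigma> e" "card e = 2"
  shows "pair_delta \<sigma> e = 0"
proof -
  obtain y z where "e = {y, z}" "y \<noteq> z"
    using assms by (auto simp: card_2_iff)
  with assms show ?thesis
    by (auto simp: pair_delta_doubleton kdelta_def)
qed

lemma pair_delta_cong:
  assumes "card e = 2" "\<And>x. x \<in> e \<Longrightarrow> \<sigma> x = \<tau> x"
  shows "pair_delta \<sigma> e = pair_delta \<tau> e"
proof -
  obtain y z where "e = {y, z}"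
    using assms by (auto simp: card_2_iff)
  with assms(2) show ?thesis
    by (simp add: pair_delta_doubleton)
qed

section \<open>Integrating out the Boltzmann weight\<close>

locale potts_model = rooted_cayley_tree V L x0
  for V :: "'v set" and L :: "'v set set" and x0 :: 'v +
  fixes J J1 \<alpha> \<beta> :: real
begin

abbreviation H :: "nat \<Rightarrow> ('v \<Rightarrow> real) \<Rightarrow> real" where "H \<equiv> hamiltonian V L x0 J J1 \<alpha>"

abbreviation weight :: "(real \<Rightarrow> 'v \<Rightarrow> real) \<Rightarrow> nat \<Rightarrow> ('v \<Rightarrow> real) \<Rightarrow> real" where
  "weight \<equiv> boltzmann_weight V L x0 J J1 \<alpha> \<beta>"

abbreviation Z :: "(real \<Rightarrow> 'v \<Rightarrow> real) \<Rightarrow> nat \<Rightarrow> real" where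
  "Z \<equiv> partition_function V L x0 J J1 \<alpha> \<beta>"

abbreviation dens :: "(real \<Rightarrow> 'v \<Rightarrow> real) \<Rightarrow> nat \<Rightarrow> ('v \<Rightarrow> real) \<Rightarrow> real" where
  "dens \<equiv> gibbs_density V L x0 J J1 \<alpha> \<beta>"

section \<open>Locality, splitting and measurability of the Hamiltonian\<close>

lemma hamiltonian_cong:
  assumes n: "n \<ge> 1" and eq: "\<And>x. x \<in> B n \<Longrightarrow> \<sigma> x = \<tau> x"
  shows "H n \<sigma> = H n \<tau>"
proof -
  \<comment> \<open>For \<open>n \<ge> 1\<close> the successors of vertices in
    \<open>B (n - 1)\<close> stay in \<open>B n\<close>; at \<open>n = 0\<close> truncated
    subtraction would let them leave the ball.\<close>
  have "pair_delta \<sigma> e = pair_delta \<tau> e"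
    if "x \<in> B (n - 1)" "e \<subseteq> succs V L x0 x" "card e = 2" for x e
    using that n succs_subset_ball[OF that(1)] by (intro pair_delta_cong eq) auto
  moreover have "pair_delta \<sigma> e = pair_delta \<tau> e" if "e \<in> L" "e \<subseteq> B n" for e
    using that by (intro pair_delta_cong eq edge_card) auto
  ultimately show ?thesis
    unfolding hamiltonian_def using eq
    by (intro arg_cong2[where f = minus] arg_cong2[where f = times] refl sum.cong) auto
qed

text \<open>The interactions of \<open>H n\<close> absent from \<open>H (n - 1)\<close> belong to
  pairs not contained in the smaller ball. Once their deltas vanish, only the external field on
  \<open>W n\<close> is new.\<close>

lemma hamiltonian_split:
  assumes n: "n \<ge> 2"
    and zero: "\<And>e. \<lbrakk>e \<subseteq> B n; card e = 2; \<not> e \<subseteq> B (n - 1)\<rbrakk> \<Longrightarrow> pair_delta \<sigma> e = 0"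
  shows "H n \<sigma> = H (n - 1) \<sigma> - \<alpha> * (\<Sum>x\<in>W n. \<sigma> x)"
proof -
  have n': "Suc (n - Suc 0) = n" using n by simp
  have "(\<Sum>x\<in>B (n - 1). \<Sum>e\<in>{e. e \<subseteq> succs V L x0 x \<and> card e = 2}. pair_delta \<sigma> e)
      = (\<Sum>x\<in>B (n - 1 - 1). \<Sum>e\<in>{e. e \<subseteq> succs V L x0 x \<and> card e = 2}. pair_delta \<sigma> e)"
  proof (rule sum.mono_neutral_right[OF finite_ball ball_mono], simp, intro ballI sum.neutral)
    fix x e
    assume "x \<in> B (n - 1) - B (n - 1 - 1)" and e: "e \<in> {e. e \<subseteq> succs V L x0 x \<and> card e = 2}"
    \<comment> \<open>Parents that are new at this radius lie on \<open>W (n - 1)\<close>, so their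
      successor pairs lie in \<open>W n\<close> and miss the smaller ball.\<close>
    then have "x \<in> W (n - 1)"
      using ball_split[of "n - 1"] n by auto
    then have "e \<subseteq> W n"
      using e succs_subset[of x "n - 1"] n' by auto
    moreover have "e \<noteq> {}" using e by auto
    ultimately show "pair_delta \<sigma> e = 0"
      using e ball_sphere_disjoint[of n] sphere_subset_ball[of n] n by (intro zero) auto
  qed
  moreover have "(\<Sum>e\<in>{e \<in> L. e \<subseteq> B n}. pair_delta \<sigma> e) = (\<Sum>e\<in>{e \<in> L. e \<subseteq> B (n - 1)}. pair_delta \<sigma> e)"
  proof (rule sum.mono_neutral_right)
    show "finite {e \<in> L. e \<subseteq> B n}"
      by (rule finite_subset[of _ "Pow (B n)"]) (auto simp: finite_ball)
    show "{e \<in> L. e \<subseteq> B (n - 1)} \<subseteq> {e \<in> L. e \<subseteq> B n}"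
      using ball_mono[of "n - 1" n] by auto
    show "\<forall>e\<in>{e \<in> L. e \<subseteq> B n} - {e \<in> L. e \<subseteq> B (n - 1)}. pair_delta \<sigma> e = 0"
      using edge_card zero by blast
  qed
  moreover have "(\<Sum>x\<in>B n. \<sigma> x) = (\<Sum>x\<in>B (n - 1). \<sigma> x) + (\<Sum>x\<in>W n. \<sigma> x)"
    using ball_split[of n] ball_sphere_disjoint[of n] n
    by (simp add: sum.union_disjoint finite_ball finite_sphere)
  ultimately show ?thesis
    unfolding hamiltonian_def by (simp only:) (simp add: algebra_simps)
qed

text \<open>Distinct spins leave no delta, only the external field; under
  \<open>conf_measure (B n)\<close> this is the almost sure case.\<close>

lemma hamiltonian_inj:
  assumes n: "n \<ge> 1" and inj: "inj_on \<sigma> (B n)"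
  shows "H n \<sigma> = - \<alpha> * (\<Sum>x\<in>B n. \<sigma> x)"
proof -
  have "pair_delta \<sigma> e = 0" if "x \<in> B (n - 1)" "e \<subseteq> succs V L x0 x" "card e = 2" for x e
    using that n succs_subset_ball[OF that(1)]
    by (intro pair_delta_eq_0 inj_on_subset[OF inj]) auto
  moreover have "pair_delta \<sigma> e = 0" if "e \<in> L" "e \<subseteq> B n" for e
    using that by (intro pair_delta_eq_0 inj_on_subset[OF inj] edge_card) auto
  ultimately show ?thesis
    unfolding hamiltonian_def by simp
qed

lemma measurable_hamiltonian:
  assumes n: "n \<ge> 1"
  shows "H n \<in> borel_measurable (conf_measure (B n))"
proof -
  have "(\<lambda>\<sigma>. pair_delta \<sigma> e) \<in> borel_measurable (conf_measure (B n))"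
    if "x \<in> B (n - 1)" "e \<subseteq> succs V L x0 x" "card e = 2" for x e
    using that n succs_subset_ball[OF that(1)] by (intro measurable_pair_delta) auto
  moreover have "(\<lambda>\<sigma>. pair_delta \<sigma> e) \<in> borel_measurable (conf_measure (B n))"
    if "e \<in> L" "e \<subseteq> B n" for e
    using that by (intro measurable_pair_delta edge_card) auto
  moreover note borel_measurable_conf_component
  ultimately show ?thesis
    unfolding hamiltonian_def[abs_def]
    by (intro borel_measurable_diff borel_measurable_times borel_measurable_sum borel_measurable_const) auto
qed

lemma weight_eq: "weight h n \<sigma> = exp (- \<beta> * H n \<sigma>) * exp (\<Sum>x\<in>W n. h (\<sigma> x) x)"
  unfolding boltzmann_weight_def by (rule exp_add)

lemma measurable_weight:
  assumes n: "n \<ge> 1" and h: "boundary_field V x0 h"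
  shows "weight h n \<in> borel_measurable (conf_measure (B n))"
proof -
  have "(\<lambda>\<sigma>. h (\<sigma> x) x) \<in> borel_measurable (conf_measure (B n))" if "x \<in> W n" for x
  proof -
    have "(\<lambda>t. h t x) \<in> borel_measurable spin_measure"
      using h sphere_subset[OF n] that by (auto simp: boundary_field_def)
    with that sphere_subset_ball[of n] show ?thesis
      by (intro measurable_compose[OF measurable_conf_component]) auto
  qed
  then show ?thesis
    unfolding boltzmann_weight_def[abs_def]
    by (intro measurable_compose[OF _ borel_measurable_exp] borel_measurable_add borel_measurable_sum
        borel_measurable_times borel_measurable_const measurable_hamiltonian[OF n])
qed

section \<open>One-site integrals\<close>

lemma integrable_one_site:
  assumes "f \<in> borel_measurable spin_measure" "bounded (f ` {0..1})"
  shows "integrable spin_measure (\<lambda>t. exp (\<beta> * \<alpha> * t + f t))"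
    and "(LINT t|spin_measure. exp (\<beta> * \<alpha> * t + f t)) > 0"
proof -
  interpret S: prob_space spin_measure by (rule prob_space_spin_measure)
  obtain C where C: "\<And>t. t \<in> {0..1} \<Longrightarrow> \<bar>f t\<bar> \<le> C"
    using assms(2) unfolding bounded_iff by fastforce
  \<comment> \<open>A bounded exponent keeps the integrand between two positive constants: the upper
    one gives integrability on a probability space, the lower one a strictly positive
    integral.\<close>
  have bd: "\<bar>\<beta> * \<alpha> * t + f t\<bar> \<le> \<bar>\<beta> * \<alpha>\<bar> + C" if "t \<in> {0..1}" for t
  proof -
    have "\<bar>\<beta> * \<alpha> * t\<bar> \<le> \<bar>\<beta> * \<alpha>\<bar>"
      using that by (simp add: abs_mult mult_left_le)
    with C[OF that] show ?thesis by linarith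
  qed
  note [measurable] = assms(1)
  have "norm (exp (\<beta> * \<alpha> * t + f t)) \<le> exp (\<bar>\<beta> * \<alpha>\<bar> + C)" if "t \<in> {0..1}" for t
    using bd[OF that] by simp
  then show int: "integrable spin_measure (\<lambda>t. exp (\<beta> * \<alpha> * t + f t))"
    by (intro S.integrable_const_bound[of _ "exp (\<bar>\<beta> * \<alpha>\<bar> + C)"]) (auto intro!: AE_I2)
  have "exp (- (\<bar>\<beta> * \<alpha>\<bar> + C)) \<le> exp (\<beta> * \<alpha> * t + f t)" if "t \<in> {0..1}" for t
    using bd[OF that] by simp
  then have "exp (- (\<bar>\<beta> * \<alpha>\<bar> + C)) \<le> (LINT t|spin_measure. exp (\<beta> * \<alpha> * t + f t))"
    using int by (intro S.integral_ge_const) (auto intro!: AE_I2)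
  then show "(LINT t|spin_measure. exp (\<beta> * \<alpha> * t + f t)) > 0"
    using less_le_trans[OF exp_gt_zero] by blast
qed

lemma free_site_integrable:
  "integrable spin_measure (\<lambda>t. exp (\<beta> * \<alpha> * t))"
  "(LINT t|spin_measure. exp (\<beta> * \<alpha> * t)) > 0"
proof -
  have "bounded ((\<lambda>_. 0 :: real) ` {0..1 :: real})"
    by (simp add: image_constant_conv)
  with integrable_one_site[of "\<lambda>_. 0"] show
    "integrable spin_measure (\<lambda>t. exp (\<beta> * \<alpha> * t))"
    "(LINT t|spin_measure. exp (\<beta> * \<alpha> * t)) > 0"
    by simp_all
qed

lemma field_integrable:
  assumes "boundary_field V x0 h" "x \<in> V - {x0}"
  shows "integrable spin_measure (\<lambda>t. exp (\<beta> * \<alpha> * t + h t x))"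
    and "(LINT t|spin_measure. exp (\<beta> * \<alpha> * t + h t x)) > 0"
  using assms integrable_one_site[of "\<lambda>t. h t x"] by (auto simp: boundary_field_def)

text \<open>Almost every \<omega> is injective on \<open>W n\<close> and avoids the finitely many
  values of \<sigma>, so no delta involving \<open>W n\<close> survives; what depends on \<omega> is
  a product over sites, integrated by Fubini. Coincidences within \<sigma> are kept in
  \<open>H (n - 1) \<sigma>\<close>, so the identity holds for every \<sigma>, as compatibility
  demands.\<close>

lemma integral_weight_merge:
  assumes n: "n \<ge> 2" and h: "boundary_field V x0 h" and \<sigma>: "\<sigma> \<in> B (n - 1) \<rightarrow>\<^sub>E {0..1}"
  shows "(LINT \<omega>|conf_measure (W n). weight h n (merge (B (n - 1)) (W n) (\<sigma>, \<omega>)))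
       = exp (- \<beta> * H (n - 1) \<sigma>) * (\<Prod>x\<in>W n. LINT t|spin_measure. exp (\<beta> * \<alpha> * t + h t x))"
proof -
  let ?m = "\<lambda>\<omega>. merge (B (n - 1)) (W n) (\<sigma>, \<omega>)"
  have split: "B n = B (n - 1) \<union> W n" and disj: "B (n - 1) \<inter> W n = {}"
    using ball_split[of n] ball_sphere_disjoint[of n] n by auto
  have mB: "?m \<omega> x = \<sigma> x" if "x \<in> B (n - 1)" for \<omega> x
    using that by (simp add: merge_def)
  have mW: "?m \<omega> x = \<omega> x" if "x \<in> W n" for \<omega> x
    using that disj by (auto simp: merge_def)
  have "AE \<omega> in conf_measure (W n). inj_on \<omega> (W n) \<and> \<omega> ` W n \<inter> \<sigma> ` B (n - 1) = {}"
    by (intro AE_conf_measure_generic finite_sphere finite_imageI finite_ball)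
  then have ae: "AE \<omega> in conf_measure (W n).
      weight h n (?m \<omega>) = exp (- \<beta> * H (n - 1) \<sigma>) * (\<Prod>x\<in>W n. exp (\<beta> * \<alpha> * \<omega> x + h (\<omega> x) x))"
  proof eventually_elim
    case (elim \<omega>)
    \<comment> \<open>Such a pair has a vertex on the sphere. Its partner is either in the smaller
      ball, where \<omega> avoids the value of \<sigma>, or on the sphere, where injectivity of
      \<omega> applies.\<close>
    have "pair_delta (?m \<omega>) e = 0" if e: "e \<subseteq> B n" "card e = 2" "\<not> e \<subseteq> B (n - 1)" for e
    proof -
      obtain y z where yz: "e = {y, z}" "y \<noteq> z" "y \<in> W n"
        using e split by (auto simp: card_2_iff)
      have "?m \<omega> y \<noteq> ?m \<omega> z"
      proof (cases "z \<in> B (n - 1)")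
        case True
        then have "\<omega> y \<noteq> \<sigma> z"
          using elim yz(3) by blast
        then show ?thesis
          by (simp only: mB[OF True] mW[OF yz(3)] not_False_eq_True)
      next
        case False
        then have z: "z \<in> W n"
          using e(1) split yz(1) by blast
        then have "\<omega> y \<noteq> \<omega> z"
          using elim yz by (blast dest: inj_onD)
        then show ?thesis
          by (simp only: mW[OF z] mW[OF yz(3)] not_False_eq_True)
      qed
      then show ?thesis
        by (simp add: yz pair_delta_doubleton kdelta_def)
    qed
    then have "H n (?m \<omega>) = H (n - 1) (?m \<omega>) - \<alpha> * (\<Sum>x\<in>W n. ?m \<omega> x)"
      by (intro hamiltonian_split n)
    also have "H (n - 1) (?m \<omega>) = H (n - 1) \<sigma>"
      using n by (intro hamiltonian_cong mB) auto
    also have "(\<Sum>x\<in>W n. ?m \<omega> x) = (\<Sum>x\<in>W n. \<omega> x)"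
      by (intro sum.cong refl mW)
    finally have Hn: "H n (?m \<omega>) = H (n - 1) \<sigma> - \<alpha> * (\<Sum>x\<in>W n. \<omega> x)" .
    have "(\<Sum>x\<in>W n. h (?m \<omega> x) x) = (\<Sum>x\<in>W n. h (\<omega> x) x)"
      by (intro sum.cong refl) (simp only: mW)
    with Hn have "- \<beta> * H n (?m \<omega>) + (\<Sum>x\<in>W n. h (?m \<omega> x) x)
        = - \<beta> * H (n - 1) \<sigma> + (\<Sum>x\<in>W n. \<beta> * \<alpha> * \<omega> x + h (\<omega> x) x)"
      by (simp only:) (simp add: sum.distrib mult.assoc right_diff_distrib flip: sum_distrib_left)
    then show ?case
      by (simp only: boltzmann_weight_def exp_add[of "- \<beta> * H (n - 1) \<sigma>"] exp_sum[OF finite_sphere])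
  qed
  have intf: "integrable spin_measure (\<lambda>t. exp (\<beta> * \<alpha> * t + h t x))" if "x \<in> W n" for x
    using field_integrable(1)[OF h] sphere_subset[of n] that n by auto
  have mm: "?m \<in> measurable (conf_measure (W n)) (conf_measure (B n))"
    unfolding split conf_measure_def
    by (rule measurable_compose[OF measurable_Pair1' measurable_merge])
       (use \<sigma> in \<open>simp add: space_PiM\<close>)
  have "(LINT \<omega>|conf_measure (W n). weight h n (?m \<omega>))
      = (LINT \<omega>|conf_measure (W n). exp (- \<beta> * H (n - 1) \<sigma>) * (\<Prod>x\<in>W n. exp (\<beta> * \<alpha> * \<omega> x + h (\<omega> x) x)))"
  proof (rule integral_cong_AE[OF _ _ ae])
    show "(\<lambda>\<omega>. weight h n (?m \<omega>)) \<in> borel_measurable (conf_measure (W n))"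
      using n h by (intro measurable_compose[OF mm measurable_weight]) auto
    show "(\<lambda>\<omega>. exp (- \<beta> * H (n - 1) \<sigma>) * (\<Prod>x\<in>W n. exp (\<beta> * \<alpha> * \<omega> x + h (\<omega> x) x)))
        \<in> borel_measurable (conf_measure (W n))"
      using intf by (intro borel_measurable_times borel_measurable_const borel_measurable_prod
          measurable_compose[OF measurable_conf_component]) auto
  qed
  also have "\<dots> = exp (- \<beta> * H (n - 1) \<sigma>) * (\<Prod>x\<in>W n. LINT t|spin_measure. exp (\<beta> * \<alpha> * t + h t x))"
    using integral_conf_prod[OF finite_sphere intf] by simp
  finally show ?thesis .
qed

section \<open>Product form of the weight and of the partition function\<close>

lemma AE_weight:
  assumes n: "n \<ge> 1"
  shows "AE \<sigma> in conf_measure (B n).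
    weight h n \<sigma> = (\<Prod>x\<in>B n. exp (\<beta> * \<alpha> * \<sigma> x + (if x \<in> W n then h (\<sigma> x) x else 0)))"
proof -
  \<comment> \<open>Here all spins of the ball vary and none is held fixed, so the set of values to
    avoid is empty and only injectivity is used.\<close>
  have "AE \<sigma> in conf_measure (B n). inj_on \<sigma> (B n) \<and> \<sigma> ` B n \<inter> {} = {}"
    by (intro AE_conf_measure_generic finite_ball) auto
  then show ?thesis
  proof eventually_elim
    case (elim \<sigma>)
    have "B n \<inter> W n = W n" using sphere_subset_ball[of n] by auto
    then have "- \<beta> * H n \<sigma> + (\<Sum>x\<in>W n. h (\<sigma> x) x)
        = (\<Sum>x\<in>B n. \<beta> * \<alpha> * \<sigma> x + (if x \<in> W n then h (\<sigma> x) x else 0))"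
      using elim hamiltonian_inj[OF n, of \<sigma>]
      by (simp add: sum.distrib sum.inter_restrict[symmetric] finite_ball sum_distrib_left[symmetric]
          mult.assoc)
    then show ?case
      by (simp add: boltzmann_weight_def exp_sum finite_ball)
  qed
qed

lemma site_integrable:
  assumes n: "n \<ge> 1" and h: "boundary_field V x0 h"
  shows "integrable spin_measure (\<lambda>t. exp (\<beta> * \<alpha> * t + (if x \<in> W n then h t x else 0)))"
    and "(LINT t|spin_measure. exp (\<beta> * \<alpha> * t + (if x \<in> W n then h t x else 0))) > 0"
proof -
  have "integrable spin_measure (\<lambda>t. exp (\<beta> * \<alpha> * t + (if x \<in> W n then h t x else 0))) \<and>
      (LINT t|spin_measure. exp (\<beta> * \<alpha> * t + (if x \<in> W n then h t x else 0))) > 0"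
  proof (cases "x \<in> W n")
    case True
    then have "x \<in> V - {x0}"
      using sphere_subset[OF n] by blast
    from field_integrable[OF h this] True show ?thesis
      by simp
  next
    case False
    with free_site_integrable show ?thesis
      by simp
  qed
  then show "integrable spin_measure (\<lambda>t. exp (\<beta> * \<alpha> * t + (if x \<in> W n then h t x else 0)))"
    and "(LINT t|spin_measure. exp (\<beta> * \<alpha> * t + (if x \<in> W n then h t x else 0))) > 0"
    by blast+
qed

text \<open>The weight agrees almost everywhere with a product over sites, so its integral
  factorises; positivity of the partition function is then read off from the factors.\<close>

lemma partition_function_eq:
  assumes n: "n \<ge> 1" and h: "boundary_field V x0 h"
  shows "Z h n = (\<Prod>x\<in>B n. LINT t|spin_measure. exp (\<beta> * \<alpha> * t + (if x \<in> W n then h t x else 0)))"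
proof -
  have "Z h n = (LINT \<sigma>|conf_measure (B n).
      (\<Prod>x\<in>B n. exp (\<beta> * \<alpha> * \<sigma> x + (if x \<in> W n then h (\<sigma> x) x else 0))))"
    unfolding partition_function_def
  proof (rule integral_cong_AE[OF measurable_weight[OF n h] _ AE_weight[OF n]])
    show "(\<lambda>\<sigma>. \<Prod>x\<in>B n. exp (\<beta> * \<alpha> * \<sigma> x + (if x \<in> W n then h (\<sigma> x) x else 0)))
        \<in> borel_measurable (conf_measure (B n))"
      by (intro borel_measurable_prod measurable_compose[OF measurable_conf_component
            borel_measurable_integrable[OF site_integrable(1)[OF n h]]])
  qed
  also have "\<dots> = (\<Prod>x\<in>B n. LINT t|spin_measure. exp (\<beta> * \<alpha> * t + (if x \<in> W n then h t x else 0)))"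
    by (rule integral_conf_prod[OF finite_ball site_integrable(1)[OF n h]])
  finally show ?thesis .
qed

lemma partition_function_pos:
  assumes "n \<ge> 1" "boundary_field V x0 h"
  shows "Z h n > 0"
  unfolding partition_function_eq[OF assms] by (intro prod_pos site_integrable(2)[OF assms])

section \<open>Compatible boundary fields\<close>

lemma boundary_field_0: "boundary_field V x0 (\<lambda>_ _. 0)"
  by (auto simp: boundary_field_def intro!: boundedI[of _ 0])

text \<open>With zero field, sites on the sphere and inside contribute the same factor
  \<open>?z\<close>, so the partition function is \<open>?z\<close> to the number of vertices of the
  ball. Its growth from \<open>B (n - 1)\<close> to \<open>B n\<close> is exactly the factor
  produced by integrating over \<open>W n\<close>.\<close>

lemma compatible_0: "compatible V L x0 J J1 \<alpha> \<beta> (\<lambda>_ _. 0)"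
  unfolding compatible_def
proof (intro allI impI ballI)
  fix n :: nat and \<sigma> :: "'v \<Rightarrow> real"
  assume n: "2 \<le> n" and \<sigma>: "\<sigma> \<in> B (n - 1) \<rightarrow>\<^sub>E {0..1}"
  let ?z = "LINT t|spin_measure. exp (\<beta> * \<alpha> * t)"
  have "card (B n) = card (B (n - 1)) + card (W n)"
    using ball_split[of n] ball_sphere_disjoint[of n] n
    by (simp add: card_Un_disjoint finite_ball finite_sphere)
  moreover have "Z (\<lambda>_ _. 0) m = ?z ^ card (B m)" if "m \<ge> 1" for m
    by (subst partition_function_eq[OF that boundary_field_0]) simp
  ultimately have "Z (\<lambda>_ _. 0) n = Z (\<lambda>_ _. 0) (n - 1) * ?z ^ card (W n)"
    using n by (simp add: power_add)
  moreover have "?z > 0"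
    by (rule free_site_integrable(2))
  ultimately show "(LINT \<omega>|conf_measure (W n). dens (\<lambda>_ _. 0) n (merge (B (n - 1)) (W n) (\<sigma>, \<omega>)))
      = dens (\<lambda>_ _. 0) (n - 1) \<sigma>"
    unfolding gibbs_density_def using integral_weight_merge[OF n boundary_field_0 \<sigma>]
    by (simp add: weight_eq[of _ "n - Suc 0"])
qed

text \<open>Both sides of the compatibility equation between the radii \<open>Suc m\<close> and
  \<open>m\<close> contain \<open>exp (- \<beta> * H m \<sigma>)\<close>. Cancelling it shows that
  the sum of the fields over \<open>W m\<close> is the same for every \<sigma>; varying the spin at
  \<open>x\<close> alone then isolates \<open>h t x\<close>.\<close>

lemma compatible_field_const:
  assumes h: "boundary_field V x0 h" and comp: "compatible V L x0 J J1 \<alpha> \<beta> h"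
    and x: "x \<in> V - {x0}" and t: "t \<in> {0..1}"
  shows "h t x = h 0 x"
proof -
  obtain m where m: "m \<ge> 1" "x \<in> W m"
    using in_sphere[OF x] .
  \<comment> \<open>The value found by solving the compatibility equation for the exponential of the
    field sum. The \<open>t\<close> inside the integral is bound there and unrelated to the given
    spin value.\<close>
  define C where "C = Z h m * (\<Prod>y\<in>W (Suc m). LINT t|spin_measure. exp (\<beta> * \<alpha> * t + h t y)) / Z h (Suc m)"
  have C: "exp (\<Sum>y\<in>W m. h (\<sigma> y) y) = C" if \<sigma>: "\<sigma> \<in> B m \<rightarrow>\<^sub>E {0..1}" for \<sigma>
  proof -
    have pos: "Z h m > 0" "Z h (Suc m) > 0"
      using m by (auto intro: partition_function_pos h)
    have "(LINT \<omega>|conf_measure (W (Suc m)). dens h (Suc m) (merge (B m) (W (Suc m)) (\<sigma>, \<omega>)))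
        = dens h m \<sigma>"
      using comp[unfolded compatible_def, rule_format, of "Suc m" \<sigma>] m \<sigma> by simp
    then have "exp (- \<beta> * H m \<sigma>) * (\<Prod>y\<in>W (Suc m). LINT t|spin_measure. exp (\<beta> * \<alpha> * t + h t y)) / Z h (Suc m)
        = exp (- \<beta> * H m \<sigma>) * exp (\<Sum>y\<in>W m. h (\<sigma> y) y) / Z h m"
      unfolding gibbs_density_def using integral_weight_merge[of "Suc m" h \<sigma>] m h \<sigma>
      by (simp add: weight_eq[of _ m])
    then show ?thesis
      using pos by (simp add: C_def field_simps)
  qed
  \<comment> \<open>Test configurations with spin \<open>s\<close> at \<open>x\<close> and 0
    elsewhere in the ball: comparing \<open>s = t\<close> with \<open>s = 0\<close>, the fields at
    all other vertices cancel.\<close>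
  define \<sigma> where "\<sigma> s = (\<lambda>y\<in>B m. if y = x then s else (0 :: real))" for s
  have "exp (\<Sum>y\<in>W m. h (\<sigma> t y) y) = exp (\<Sum>y\<in>W m. h (\<sigma> 0 y) y)"
    using C[of "\<sigma> t"] C[of "\<sigma> 0"] t by (auto simp: \<sigma>_def)
  moreover have "(\<Sum>y\<in>W m. h (\<sigma> s y) y) = h s x + (\<Sum>y\<in>W m - {x}. h 0 y)" for s
  proof -
    have "\<sigma> s y = (if y = x then s else 0)" if "y \<in> W m" for y
      using that sphere_subset_ball[of m] by (auto simp: \<sigma>_def)
    with m(2) show ?thesis
      by (subst sum.remove[OF finite_sphere m(2)]) simp
  qed
  ultimately show ?thesis
    by simp
qed

section \<open>The product measure\<close>

definition site_const :: real where
  "site_const = (LINT t|spin_measure. exp (\<beta> * \<alpha> * t))"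

text \<open>The law of a free spin in the external field: an exponential law truncated to the unit
  interval, uniform when \<open>\<beta> * \<alpha> = 0\<close>.\<close>

definition site_measure :: "real measure" where
  "site_measure = density spin_measure (\<lambda>t. ennreal (exp (\<beta> * \<alpha> * t) / site_const))"

lemma site_const_pos: "site_const > 0"
  unfolding site_const_def by (rule free_site_integrable(2))

lemma prob_space_site_measure: "prob_space site_measure"
proof (rule prob_spaceI)
  have "integrable spin_measure (\<lambda>t. exp (\<beta> * \<alpha> * t))"
    by (rule free_site_integrable(1))
  then have "(\<integral>\<^sup>+t. ennreal (exp (\<beta> * \<alpha> * t) / site_const) \<partial>spin_measure) = ennreal (site_const / site_const)"
    using site_const_pos by (subst nn_integral_eq_integral) (auto simp: site_const_def)
  also have "ennreal (site_const / site_const) = 1"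
    using site_const_pos by simp
  finally have int: "(\<integral>\<^sup>+t. ennreal (exp (\<beta> * \<alpha> * t) / site_const) \<partial>spin_measure) = 1" .
  have "emeasure site_measure (space site_measure)
      = (\<integral>\<^sup>+t. ennreal (exp (\<beta> * \<alpha> * t) / site_const) * indicator (space spin_measure) t \<partial>spin_measure)"
    unfolding site_measure_def space_density by (rule emeasure_density) measurable
  also have "\<dots> = 1"
    unfolding int[symmetric] by (intro nn_integral_cong) simp
  finally show "emeasure site_measure (space site_measure) = 1" .
qed

lemma sets_PiM_site_measure: "sets (PiM A (\<lambda>_. site_measure)) = sets (conf_measure A)"
  unfolding conf_measure_def by (intro sets_PiM_cong) (auto simp: site_measure_def)

text \<open>A finite product measure is determined by its values on boxes, and over a box the
  integral of a product density factorises into one-site masses.\<close>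

lemma density_conf_prod:
  assumes "finite A"
  shows "density (conf_measure A) (\<lambda>\<sigma>. ennreal (\<Prod>x\<in>A. exp (\<beta> * \<alpha> * \<sigma> x) / site_const))
       = PiM A (\<lambda>_. site_measure)"
proof -
  interpret N: prob_space site_measure by (rule prob_space_site_measure)
  interpret S: prob_space spin_measure by (rule prob_space_spin_measure)
  interpret product_sigma_finite "\<lambda>_. site_measure" ..
  interpret P: product_sigma_finite "\<lambda>_. spin_measure" ..
  let ?f = "\<lambda>t. ennreal (exp (\<beta> * \<alpha> * t) / site_const)"
  have f[measurable]: "?f \<in> borel_measurable spin_measure" by measurable
  show ?thesis
  proof (rule PiM_eqI[OF assms])
    show "sets (density (conf_measure A) (\<lambda>\<sigma>. ennreal (\<Prod>x\<in>A. exp (\<beta> * \<alpha> * \<sigma> x) / site_const)))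
        = sets (PiM A (\<lambda>_. site_measure))"
      by (simp add: sets_PiM_site_measure)
    fix X assume "\<And>i. i \<in> A \<Longrightarrow> X i \<in> sets site_measure"
    then have X: "\<And>i. i \<in> A \<Longrightarrow> X i \<in> sets spin_measure"
      by (simp add: site_measure_def)
    have PX: "Pi\<^sub>E A X \<in> sets (conf_measure A)"
      unfolding conf_measure_def using assms X by (intro sets_PiM_I_finite) auto
    have prod: "ennreal (\<Prod>x\<in>A. exp (\<beta> * \<alpha> * \<sigma> x) / site_const) = (\<Prod>x\<in>A. ?f (\<sigma> x))" for \<sigma>
      using site_const_pos by (intro prod_ennreal[symmetric]) auto
    have meas: "(\<lambda>\<sigma>. \<Prod>x\<in>A. ?f (\<sigma> x)) \<in> borel_measurable (conf_measure A)"
      by (intro borel_measurable_prod_ennreal measurable_compose[OF measurable_conf_component f])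
    have "emeasure (density (conf_measure A) (\<lambda>\<sigma>. ennreal (\<Prod>x\<in>A. exp (\<beta> * \<alpha> * \<sigma> x) / site_const))) (Pi\<^sub>E A X)
        = (\<integral>\<^sup>+\<sigma>. (\<Prod>x\<in>A. ?f (\<sigma> x)) * indicator (Pi\<^sub>E A X) \<sigma> \<partial>conf_measure A)"
      unfolding prod by (rule emeasure_density[OF meas PX])
    also have "\<dots> = (\<integral>\<^sup>+\<sigma>. (\<Prod>x\<in>A. ?f (\<sigma> x) * indicator (X x) (\<sigma> x)) \<partial>conf_measure A)"
    proof (rule nn_integral_cong)
      \<comment> \<open>Membership in the space supplies extensionality, so lying in the box reduces
        to the coordinate conditions and the indicator becomes a product.\<close>
      fix \<sigma> assume "\<sigma> \<in> space (conf_measure A)"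
      then have "indicator (Pi\<^sub>E A X) \<sigma> = (\<Prod>x\<in>A. indicator (X x) (\<sigma> x) :: ennreal)"
        using assms by (auto simp: space_conf_measure indicator_def PiE_iff)
      then show "(\<Prod>x\<in>A. ?f (\<sigma> x)) * indicator (Pi\<^sub>E A X) \<sigma> = (\<Prod>x\<in>A. ?f (\<sigma> x) * indicator (X x) (\<sigma> x))"
        by (simp add: prod.distrib)
    qed
    also have "\<dots> = (\<Prod>x\<in>A. \<integral>\<^sup>+t. ?f t * indicator (X x) t \<partial>spin_measure)"
      unfolding conf_measure_def
      by (rule P.product_nn_integral_prod[OF assms])
         (intro borel_measurable_times_ennreal f borel_measurable_indicator X)
    also have "\<dots> = (\<Prod>x\<in>A. emeasure site_measure (X x))"
      unfolding site_measure_def using X by (intro prod.cong refl emeasure_density[symmetric] f)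
    finally show "emeasure (density (conf_measure A) (\<lambda>\<sigma>. ennreal (\<Prod>x\<in>A. exp (\<beta> * \<alpha> * \<sigma> x) / site_const))) (Pi\<^sub>E A X)
        = (\<Prod>x\<in>A. emeasure site_measure (X x))" .
  qed
qed

text \<open>A field independent of the spin multiplies weight and partition function by the same
  constant, which leaves almost everywhere the product of the free one-site densities.\<close>

lemma density_gibbs_const_field:
  assumes n: "n \<ge> 1" and h: "boundary_field V x0 h"
    and const: "\<And>x t. \<lbrakk>x \<in> V - {x0}; t \<in> {0..1}\<rbrakk> \<Longrightarrow> h t x = h 0 x"
  shows "density (conf_measure (B n)) (\<lambda>\<sigma>. ennreal (dens h n \<sigma>)) = PiM (B n) (\<lambda>_. site_measure)"
proof -
  \<comment> \<open>The constant field as seen by each site of the ball: its value at spin 0 on the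
    sphere, and 0 inside, where no boundary field acts.\<close>
  define c where "c x = (if x \<in> W n then h 0 x else 0)" for x
  have c: "(if x \<in> W n then h t x else 0) = c x" if "t \<in> {0..1}" for x t
    using const[of x t] that sphere_subset[OF n] by (auto simp: c_def)
  have "(LINT t|spin_measure. exp (\<beta> * \<alpha> * t + (if x \<in> W n then h t x else 0)))
      = (LINT t|spin_measure. exp (\<beta> * \<alpha> * t) * exp (c x))" for x
    by (intro Bochner_Integration.integral_cong refl) (auto simp: exp_add c)
  then have Z: "Z h n = (\<Prod>x\<in>B n. site_const * exp (c x))"
    unfolding partition_function_eq[OF n h] site_const_def by simp
  have "AE \<sigma> in conf_measure (B n). dens h n \<sigma> = (\<Prod>x\<in>B n. exp (\<beta> * \<alpha> * \<sigma> x) / site_const)"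
    using AE_weight[OF n, of h] AE_space
  proof eventually_elim
    case (elim \<sigma>)
    then have "weight h n \<sigma> = (\<Prod>x\<in>B n. exp (\<beta> * \<alpha> * \<sigma> x) * exp (c x))"
      by (auto simp: space_conf_measure PiE_iff c exp_add intro!: prod.cong)
    then show ?case
      unfolding gibbs_density_def Z by (simp add: prod_dividef[symmetric])
  qed
  then have "AE \<sigma> in conf_measure (B n).
      ennreal (dens h n \<sigma>) = ennreal (\<Prod>x\<in>B n. exp (\<beta> * \<alpha> * \<sigma> x) / site_const)"
    by eventually_elim simp
  then have "density (conf_measure (B n)) (\<lambda>\<sigma>. ennreal (dens h n \<sigma>))
      = density (conf_measure (B n)) (\<lambda>\<sigma>. ennreal (\<Prod>x\<in>B n. exp (\<beta> * \<alpha> * \<sigma> x) / site_const))"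
  proof (rule density_cong[rotated 2])
    show "(\<lambda>\<sigma>. ennreal (dens h n \<sigma>)) \<in> borel_measurable (conf_measure (B n))"
      unfolding gibbs_density_def using measurable_weight[OF n h] by measurable
    have "(\<lambda>t. exp (\<beta> * \<alpha> * t) / site_const) \<in> borel_measurable spin_measure" by measurable
    then show "(\<lambda>\<sigma>. ennreal (\<Prod>x\<in>B n. exp (\<beta> * \<alpha> * \<sigma> x) / site_const)) \<in> borel_measurable (conf_measure (B n))"
      by (intro measurable_compose[OF _ measurable_ennreal] borel_measurable_prod
          measurable_compose[OF measurable_conf_component])
  qed
  with density_conf_prod[OF finite_ball] show ?thesis
    by simp
qed

section \<open>Identification of the measure from its finite marginals\<close>

lemma distr_restrict_PiM_site_measure:
  "distr (PiM V (\<lambda>_. site_measure)) (conf_measure (B n)) (\<lambda>\<sigma>. restrict \<sigma> (B n))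
     = PiM (B n) (\<lambda>_. site_measure)"
proof -
  interpret N: prob_space site_measure by (rule prob_space_site_measure)
  interpret product_prob_space "\<lambda>_. site_measure" V ..
  \<comment> \<open>The target of \<open>distr\<close> matters only through its measurable sets, so
    it can be exchanged for the product of site laws.\<close>
  have "distr (PiM V (\<lambda>_. site_measure)) (conf_measure (B n)) (\<lambda>\<sigma>. restrict \<sigma> (B n))
      = distr (PiM V (\<lambda>_. site_measure)) (PiM (B n) (\<lambda>_. site_measure)) (\<lambda>\<sigma>. restrict \<sigma> (B n))"
    by (intro distr_cong refl) (simp add: sets_PiM_site_measure)
  also have "\<dots> = PiM (B n) (\<lambda>_. site_measure)"
    by (rule distr_PiM_restrict_finite[OF finite_ball ball_subset])
  finally show ?thesis .
qed

text \<open>Cylinders over finite bases generate the sigma-algebra and are closed under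
  intersection. Every finite base lies in some ball, so the marginals on balls determine a
  probability measure.\<close>

lemma eq_PiM_site_measure:
  assumes "prob_space \<mu>" and sets: "sets \<mu> = sets (conf_measure V)"
    and marg: "\<And>n. n \<ge> 1 \<Longrightarrow> distr \<mu> (conf_measure (B n)) (\<lambda>\<sigma>. restrict \<sigma> (B n)) = PiM (B n) (\<lambda>_. site_measure)"
  shows "\<mu> = PiM V (\<lambda>_. site_measure)"
proof (rule measure_eqI_PiM_infinite)
  let ?P = "PiM V (\<lambda>_. site_measure)"
  interpret prob_space \<mu> by fact
  show "finite_measure \<mu>"
    by (rule finite_measure_axioms)
  show s: "sets \<mu> = sets ?P" and "sets ?P = sets ?P"
    by (simp_all add: sets sets_PiM_site_measure)
  fix A K assume K: "finite K" "K \<subseteq> V" and A: "\<And>i. i \<in> K \<Longrightarrow> A i \<in> sets site_measure"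
  obtain n where n: "n \<ge> 1" "K \<subseteq> B n"
    using finite_subset_ball[OF K] .
  let ?E = "prod_emb (B n) (\<lambda>_. site_measure) K (Pi\<^sub>E K A)"
  have E: "?E \<in> sets (conf_measure (B n))"
    unfolding sets_PiM_site_measure[symmetric] using n K A by (intro sets_PiM_I) auto
  have meas: "(\<lambda>\<sigma>. restrict \<sigma> (B n)) \<in> measurable M (conf_measure (B n))" if "sets M = sets (conf_measure V)" for M
    unfolding measurable_cong_sets[OF that refl] conf_measure_def
    using ball_subset by (rule measurable_restrict_subset)
  have space: "space M = space ?P" if "sets M = sets (conf_measure V)" for M
    using that by (intro sets_eq_imp_space_eq) (simp add: sets_PiM_site_measure)
  \<comment> \<open>Because \<open>K\<close> lies inside \<open>B n\<close>, restricting first to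
    the ball does not change the coordinates that the cylinder tests.\<close>
  have pre: "(\<lambda>\<sigma>. restrict \<sigma> (B n)) -` ?E \<inter> space ?P = prod_emb V (\<lambda>_. site_measure) K (Pi\<^sub>E K A)"
  proof -
    have "restrict \<sigma> (B n) \<in> B n \<rightarrow>\<^sub>E space site_measure" if "\<sigma> \<in> V \<rightarrow>\<^sub>E space site_measure" for \<sigma>
      using that ball_subset[of n] by (intro PiE_I) (auto dest: PiE_mem)
    moreover have "restrict (restrict \<sigma> (B n)) K = restrict \<sigma> K" for \<sigma> :: "'v \<Rightarrow> real"
      using n by (simp add: Int_absorb1)
    ultimately show ?thesis
      by (auto simp: prod_emb_def space_PiM)
  qed
  \<comment> \<open>Stated for a general \<open>M\<close> so as to apply both to \<mu> and to the
    infinite product.\<close>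
  have "emeasure M (prod_emb V (\<lambda>_. site_measure) K (Pi\<^sub>E K A)) = emeasure (PiM (B n) (\<lambda>_. site_measure)) ?E"
    if "sets M = sets (conf_measure V)"
      "distr M (conf_measure (B n)) (\<lambda>\<sigma>. restrict \<sigma> (B n)) = PiM (B n) (\<lambda>_. site_measure)" for M
    using emeasure_distr[OF meas[OF that(1)] E] that(2) pre space[OF that(1)] by simp
  from this[OF sets marg[OF n(1)]] this[OF sets_PiM_site_measure distr_restrict_PiM_site_measure]
  show "emeasure \<mu> (prod_emb V (\<lambda>_. site_measure) K (Pi\<^sub>E K A))
      = emeasure ?P (prod_emb V (\<lambda>_. site_measure) K (Pi\<^sub>E K A))"
    by simp
qed

text \<open>Naming the measure settles existence and uniqueness together.\<close>

lemma splitting_gibbs_measure_iff: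
  "splitting_gibbs_measure V L x0 J J1 \<alpha> \<beta> \<mu> \<longleftrightarrow> \<mu> = PiM V (\<lambda>_. site_measure)"
proof
  assume "splitting_gibbs_measure V L x0 J J1 \<alpha> \<beta> \<mu>"
  then obtain h where h: "boundary_field V x0 h" "compatible V L x0 J J1 \<alpha> \<beta> h"
    and \<mu>: "splitting_gibbs_measure_for V L x0 J J1 \<alpha> \<beta> h \<mu>"
    unfolding splitting_gibbs_measure_def by blast
  show "\<mu> = PiM V (\<lambda>_. site_measure)"
    using \<mu> density_gibbs_const_field[OF _ h(1) compatible_field_const[OF h]]
    unfolding splitting_gibbs_measure_for_def by (intro eq_PiM_site_measure) auto
next
  assume "\<mu> = PiM V (\<lambda>_. site_measure)"
  moreover have "prob_space (PiM V (\<lambda>_. site_measure))"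
    by (intro prob_space_PiM prob_space_site_measure)
  ultimately have "splitting_gibbs_measure_for V L x0 J J1 \<alpha> \<beta> (\<lambda>_ _. 0) \<mu>"
    unfolding splitting_gibbs_measure_for_def
    using density_gibbs_const_field[OF _ boundary_field_0] distr_restrict_PiM_site_measure
    by (simp add: sets_PiM_site_measure)
  then show "splitting_gibbs_measure V L x0 J J1 \<alpha> \<beta> \<mu>"
    unfolding splitting_gibbs_measure_def using boundary_field_0 compatible_0 by blast
qed

end

theorem proposition3p5:
  fixes V :: "'v set" and L :: "'v set set" and x0 :: 'v
    and J J1 \<alpha> \<beta> :: real
  assumes "cayley_tree_order2 V L"
    and "x0 \<in> V"
    and "\<beta> > 0"
  shows "\<exists>!\<mu>. splitting_gibbs_measure V L x0 J J1 \<alpha> \<beta> \<mu>"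
proof -
  interpret potts_model V L x0 J J1 \<alpha> \<beta>
    using assms by unfold_locales
  show ?thesis
    by (simp add: splitting_gibbs_measure_iff)
qed

end
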